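(* Let $(M,\omega)$ be a symplectic manifold, $X_0\subseteq M$ a subset, and $f\in C^\infty(M,\mathbb{R})$. The pair $(X_0,df)$ is rigidifying, provided that there exist symplectic manifolds $(\widetilde M,\widetilde\omega)$ and $(M',\omega')$, a connected Lie group $G$ with Lie algebra $\mathfrak{g}$, a Hamiltonian action of $G$ on $\widetilde M$, an (equivariant) moment map $\mu:\widetilde M\to\mathfrak{g}^*$ for the action, and a symplectomorphism $\psi:\widetilde M\to M\times M'$ (with $M\times M'$ carrying the form $\omega\oplus\omega'$) such that, denoting by $\mathrm{pr}:M\times M'\to M$ the canonical projection, the composition $f\circ\mathrm{pr}\circ\psi$ factors through $\mu$, and $$X_0=\mathrm{pr}\circ\psi\big(\mu^{-1}(0)\big).$$
   Context: All manifolds are smooth with empty boundary. For $X_0\subseteq M$ and a one-form $\alpha\in\Omega^1(M)$, the pair $(X_0,\alpha)$ is called rigidifying iff for every symplectomorphism $\phi:M\to M$ with $\phi|_{X_0}=\mathrm{id}_{X_0}$ we have $\alpha(d\phi(x)v)=\alpha(v)$ for every $x\in X_0$ and $v\in T_xM$. A map $f\in C^\infty(X,Y)$ between manifolds factors through $f'\in C^\infty(X,Y')$ iff there exists $g\in C^\infty(Y',Y)$ with $f=g\circ f'$. A moment map satisfies $\langle d\mu(x)v,\xi\rangle=\widetilde\omega(X_\xi(x),v)$ for all $\xi\in\mathfrak{g}$, $v\in T_x\widetilde M$, where $X_\xi$ is the vector field generated by $\xi$, and is by definition equivariant. *)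

theory Defs
  imports "HOL-Analysis.Analysis" "HOL-Algebra.Group_Action"
begin

section \<open>Smooth maps between normed spaces\<close>

text \<open>Only used on open subsets of finite-dimensional spaces, where this is the usual
  notion of a $C^k$ map.\<close>

primrec Ck_on :: "nat \<Rightarrow> 'a::real_normed_vector set \<Rightarrow> ('a \<Rightarrow> 'b::real_normed_vector) \<Rightarrow> bool" where
  "Ck_on 0 S f \<longleftrightarrow> continuous_on S f"
| "Ck_on (Suc k) S f \<longleftrightarrow>
     (\<forall>x\<in>S. f differentiable (at x)) \<and> (\<forall>v. Ck_on k S (\<lambda>x. frechet_derivative f (at x) v))"

definition smooth_on :: "'a::real_normed_vector set \<Rightarrow> ('a \<Rightarrow> 'b::real_normed_vector) \<Rightarrow> bool" where
  "smooth_on S f \<longleftrightarrow> (\<forall>k. Ck_on k S f)"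


section \<open>Smooth manifolds\<close>

type_synonym ('a, 'e) chart = "'a set \<times> ('a \<Rightarrow> 'e)"

record ('a, 'e) manifold =
  mtop :: "'a topology"
  atlas :: "('a, 'e) chart set"

abbreviation points :: "('a, 'e) manifold \<Rightarrow> 'a set" where
  "points M \<equiv> topspace (mtop M)"

definition chart_inv :: "('a, 'e) chart \<Rightarrow> 'e \<Rightarrow> 'a" where
  "chart_inv c = inv_into (fst c) (snd c)"

text \<open>Charts take values in an arbitrary finite-dimensional normed space instead of a type of
  class \<^class>\<open>euclidean_space\<close>, because the latter would exclude zero-dimensional
  manifolds (in particular \<open>M' = point\<close> and the trivial group).\<close>

definition smooth_manifold :: "('a, 'e::real_normed_vector) manifold \<Rightarrow> bool" where
  "smooth_manifold M \<longleftrightarrow>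
     (\<exists>B::'e set. finite B \<and> span B = UNIV) \<and>
     Hausdorff_space (mtop M) \<and> second_countable (mtop M) \<and>
     (\<Union>c\<in>atlas M. fst c) = points M \<and>
     (\<forall>c\<in>atlas M. openin (mtop M) (fst c) \<and> open (snd c ` fst c) \<and>
        homeomorphic_map (subtopology (mtop M) (fst c)) (top_of_set (snd c ` fst c)) (snd c)) \<and>
     (\<forall>c\<in>atlas M. \<forall>c'\<in>atlas M. smooth_on (snd c ` (fst c \<inter> fst c')) (snd c' \<circ> chart_inv c))"

definition smooth_map ::
  "('a, 'e::real_normed_vector) manifold \<Rightarrow> ('b, 'f::real_normed_vector) manifold \<Rightarrow> ('a \<Rightarrow> 'b) \<Rightarrow> bool"
  where
  "smooth_map M N F \<longleftrightarrow>
     continuous_map (mtop M) (mtop N) F \<and>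
     (\<forall>c\<in>atlas M. \<forall>c'\<in>atlas N.
        smooth_on (snd c ` {p \<in> fst c. F p \<in> fst c'}) (snd c' \<circ> F \<circ> chart_inv c))"

definition diffeomorphism ::
  "('a, 'e::real_normed_vector) manifold \<Rightarrow> ('b, 'f::real_normed_vector) manifold \<Rightarrow> ('a \<Rightarrow> 'b) \<Rightarrow> bool"
  where
  "diffeomorphism M N F \<longleftrightarrow>
     bij_betw F (points M) (points N) \<and> smooth_map M N F \<and>
     smooth_map N M (inv_into (points M) F)"

definition factors_through ::
  "('a, 'e::real_normed_vector) manifold \<Rightarrow> ('b, 'f::real_normed_vector) manifold \<Rightarrow>
   ('c, 'h::real_normed_vector) manifold \<Rightarrow> ('a \<Rightarrow> 'b) \<Rightarrow> ('a \<Rightarrow> 'c) \<Rightarrow> bool"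
  where
  "factors_through X Y Y' f f' \<longleftrightarrow> (\<exists>g. smooth_map Y' Y g \<and> (\<forall>x\<in>points X. f x = g (f' x)))"

definition real_line :: "(real, real) manifold" where
  "real_line = \<lparr>mtop = euclidean, atlas = {(UNIV, id)}\<rparr>"

definition prod_manifold ::
  "('a, 'e) manifold \<Rightarrow> ('b, 'f) manifold \<Rightarrow> ('a \<times> 'b, 'e \<times> 'f) manifold"
  where
  "prod_manifold M N =
     \<lparr>mtop = prod_topology (mtop M) (mtop N),
      atlas = {(fst c \<times> fst d, map_prod (snd c) (snd d)) | c d. c \<in> atlas M \<and> d \<in> atlas N}\<rparr>"


section \<open>Tangent spaces and differentials\<close>

text \<open>A tangent vector at \<open>p\<close> is the family of its coordinate vectors with respect to all
  charts of the atlas around \<open>p\<close>, related by the derivatives of the transition maps. The vector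
  space operations are pointwise.\<close>

type_synonym ('a, 'e) tangent = "('a, 'e) chart \<Rightarrow> 'e"

definition charts_at :: "('a, 'e) manifold \<Rightarrow> 'a \<Rightarrow> ('a, 'e) chart set" where
  "charts_at M p = {c \<in> atlas M. p \<in> fst c}"

definition some_chart :: "('a, 'e) manifold \<Rightarrow> 'a \<Rightarrow> ('a, 'e) chart" where
  "some_chart M p = (SOME c. c \<in> charts_at M p)"

definition transition_deriv ::
  "('a, 'e::real_normed_vector) chart \<Rightarrow> ('a, 'e) chart \<Rightarrow> 'a \<Rightarrow> 'e \<Rightarrow> 'e"
  where
  "transition_deriv c c' p = frechet_derivative (snd c' \<circ> chart_inv c) (at (snd c p))"

definition tangent_space ::
  "('a, 'e::real_normed_vector) manifold \<Rightarrow> 'a \<Rightarrow> ('a, 'e) tangent set"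
  where
  "tangent_space M p =
     {v. (\<forall>c\<in>charts_at M p. \<forall>c'\<in>charts_at M p. v c' = transition_deriv c c' p (v c)) \<and>
         (\<forall>c. c \<notin> charts_at M p \<longrightarrow> v c = 0)}"

definition tangent_of_coord ::
  "('a, 'e::real_normed_vector) manifold \<Rightarrow> 'a \<Rightarrow> ('a, 'e) chart \<Rightarrow> 'e \<Rightarrow> ('a, 'e) tangent"
  where
  "tangent_of_coord M p c w = (\<lambda>c'. if c' \<in> charts_at M p then transition_deriv c c' p w else 0)"

text \<open>On tangent vectors of \<open>M\<close> at \<open>p\<close> the value does not depend on the chart chosen around
  \<open>p\<close>.\<close>

definition differential ::
  "('a, 'e::real_normed_vector) manifold \<Rightarrow> ('b, 'f::real_normed_vector) manifold \<Rightarrow> ('a \<Rightarrow> 'b) \<Rightarrow>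
   'a \<Rightarrow> ('a, 'e) tangent \<Rightarrow> ('b, 'f) tangent"
  where
  "differential M N F p v = (\<lambda>c'. if c' \<in> charts_at N (F p)
     then frechet_derivative (snd c' \<circ> F \<circ> chart_inv (some_chart M p))
            (at (snd (some_chart M p) p)) (v (some_chart M p))
     else 0)"


section \<open>Differential forms and symplectic manifolds\<close>

type_synonym ('a, 'e) form1 = "'a \<Rightarrow> ('a, 'e) tangent \<Rightarrow> real"
type_synonym ('a, 'e) form2 = "'a \<Rightarrow> ('a, 'e) tangent \<Rightarrow> ('a, 'e) tangent \<Rightarrow> real"

text \<open>The one-form \<open>df\<close>: the differential of \<open>f\<close>, with the tangent spaces of the real line
  identified with the reals by means of the identity chart.\<close>

definition ext_deriv :: "('a, 'e::real_normed_vector) manifold \<Rightarrow> ('a \<Rightarrow> real) \<Rightarrow> ('a, 'e) form1" where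
  "ext_deriv M f p v = differential M real_line f p v (UNIV, id)"

definition linear_on_tangent ::
  "('a, 'e::real_normed_vector) manifold \<Rightarrow> 'a \<Rightarrow> (('a, 'e) tangent \<Rightarrow> real) \<Rightarrow> bool"
  where
  "linear_on_tangent M p l \<longleftrightarrow>
     (\<forall>u\<in>tangent_space M p. \<forall>v\<in>tangent_space M p. \<forall>a b.
        l (\<lambda>c. a *\<^sub>R u c + b *\<^sub>R v c) = a * l u + b * l v)"

definition form2_coord ::
  "('a, 'e::real_normed_vector) manifold \<Rightarrow> ('a, 'e) form2 \<Rightarrow> ('a, 'e) chart \<Rightarrow> 'e \<Rightarrow> 'e \<Rightarrow> 'e \<Rightarrow> real"
  where
  "form2_coord M \<omega> c a b y =
     \<omega> (chart_inv c y) (tangent_of_coord M (chart_inv c y) c a) (tangent_of_coord M (chart_inv c y) c b)"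

definition two_form :: "('a, 'e::real_normed_vector) manifold \<Rightarrow> ('a, 'e) form2 \<Rightarrow> bool" where
  "two_form M \<omega> \<longleftrightarrow>
     (\<forall>p\<in>points M. \<forall>u\<in>tangent_space M p.
        linear_on_tangent M p (\<omega> p u) \<and> linear_on_tangent M p (\<lambda>v. \<omega> p v u) \<and> \<omega> p u u = 0) \<and>
     (\<forall>c\<in>atlas M. \<forall>a b. smooth_on (snd c ` fst c) (form2_coord M \<omega> c a b))"

text \<open>\<open>d\<omega> = 0\<close>, evaluated on the constant vector fields \<open>a\<close>, \<open>b\<close>, \<open>d\<close> of a chart.\<close>

definition closed_form2 :: "('a, 'e::real_normed_vector) manifold \<Rightarrow> ('a, 'e) form2 \<Rightarrow> bool" where
  "closed_form2 M \<omega> \<longleftrightarrow>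
     (\<forall>c\<in>atlas M. \<forall>y\<in>snd c ` fst c. \<forall>a b d.
        frechet_derivative (form2_coord M \<omega> c b d) (at y) a
      + frechet_derivative (form2_coord M \<omega> c d a) (at y) b
      + frechet_derivative (form2_coord M \<omega> c a b) (at y) d = 0)"

definition nondegenerate :: "('a, 'e::real_normed_vector) manifold \<Rightarrow> ('a, 'e) form2 \<Rightarrow> bool" where
  "nondegenerate M \<omega> \<longleftrightarrow>
     (\<forall>p\<in>points M. \<forall>u\<in>tangent_space M p. (\<forall>v\<in>tangent_space M p. \<omega> p u v = 0) \<longrightarrow> u = (\<lambda>_. 0))"

definition symplectic_manifold :: "('a, 'e::real_normed_vector) manifold \<Rightarrow> ('a, 'e) form2 \<Rightarrow> bool" where
  "symplectic_manifold M \<omega> \<longleftrightarrow>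
     smooth_manifold M \<and> two_form M \<omega> \<and> closed_form2 M \<omega> \<and> nondegenerate M \<omega>"

definition pullback_form2 ::
  "('a, 'e::real_normed_vector) manifold \<Rightarrow> ('b, 'f::real_normed_vector) manifold \<Rightarrow> ('a \<Rightarrow> 'b) \<Rightarrow>
   ('b, 'f) form2 \<Rightarrow> ('a, 'e) form2"
  where
  "pullback_form2 M N F \<omega> p u v = \<omega> (F p) (differential M N F p u) (differential M N F p v)"

definition prod_form2 ::
  "('a, 'e::real_normed_vector) manifold \<Rightarrow> ('b, 'f::real_normed_vector) manifold \<Rightarrow>
   ('a, 'e) form2 \<Rightarrow> ('b, 'f) form2 \<Rightarrow> ('a \<times> 'b, 'e \<times> 'f) form2"
  where
  "prod_form2 M N \<omega> \<omega>' p u v =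
     pullback_form2 (prod_manifold M N) M fst \<omega> p u v
   + pullback_form2 (prod_manifold M N) N snd \<omega>' p u v"

definition symplectomorphism ::
  "('a, 'e::real_normed_vector) manifold \<Rightarrow> ('a, 'e) form2 \<Rightarrow>
   ('b, 'f::real_normed_vector) manifold \<Rightarrow> ('b, 'f) form2 \<Rightarrow> ('a \<Rightarrow> 'b) \<Rightarrow> bool"
  where
  "symplectomorphism M \<omega> N \<omega>' F \<longleftrightarrow>
     diffeomorphism M N F \<and>
     (\<forall>p\<in>points M. \<forall>u\<in>tangent_space M p. \<forall>v\<in>tangent_space M p.
        pullback_form2 M N F \<omega>' p u v = \<omega> p u v)"

definition rigidifying ::
  "('a, 'e::real_normed_vector) manifold \<Rightarrow> ('a, 'e) form2 \<Rightarrow> 'a set \<Rightarrow> ('a, 'e) form1 \<Rightarrow> bool"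
  where
  "rigidifying M \<omega> X\<^sub>0 \<alpha> \<longleftrightarrow>
     (\<forall>\<phi>. symplectomorphism M \<omega> M \<omega> \<phi> \<and> (\<forall>x\<in>X\<^sub>0. \<phi> x = x) \<longrightarrow>
        (\<forall>x\<in>X\<^sub>0. \<forall>v\<in>tangent_space M x. \<alpha> (\<phi> x) (differential M M \<phi> x v) = \<alpha> x v))"


section \<open>Lie groups and Hamiltonian actions\<close>

definition lie_group :: "'g monoid \<Rightarrow> ('g, 'h::real_normed_vector) manifold \<Rightarrow> bool" where
  "lie_group \<G> G \<longleftrightarrow>
     group \<G> \<and> smooth_manifold G \<and> carrier \<G> = points G \<and>
     smooth_map (prod_manifold G G) G (\<lambda>(g, h). g \<otimes>\<^bsub>\<G>\<^esub> h) \<and>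
     smooth_map G G (\<lambda>g. inv\<^bsub>\<G>\<^esub> g)"

text \<open>The Lie algebra, as a vector space; its bracket is not needed in what follows.\<close>

definition lie_algebra ::
  "'g monoid \<Rightarrow> ('g, 'h::real_normed_vector) manifold \<Rightarrow> ('g, 'h) tangent set"
  where
  "lie_algebra \<G> G = tangent_space G \<one>\<^bsub>\<G>\<^esub>"

definition adjoint ::
  "'g monoid \<Rightarrow> ('g, 'h::real_normed_vector) manifold \<Rightarrow> 'g \<Rightarrow> ('g, 'h) tangent \<Rightarrow> ('g, 'h) tangent"
  where
  "adjoint \<G> G g = differential G G (\<lambda>h. g \<otimes>\<^bsub>\<G>\<^esub> h \<otimes>\<^bsub>\<G>\<^esub> inv\<^bsub>\<G>\<^esub> g) \<one>\<^bsub>\<G>\<^esub>"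

text \<open>Functionals on the Lie algebra are made total by the value 0 outside of it, so that the
  origin of the dual is the function that is constantly 0.\<close>

definition lie_dual ::
  "'g monoid \<Rightarrow> ('g, 'h::real_normed_vector) manifold \<Rightarrow> (('g, 'h) tangent \<Rightarrow> real) set"
  where
  "lie_dual \<G> G =
     {l. linear_on_tangent G \<one>\<^bsub>\<G>\<^esub> l \<and> (\<forall>\<xi>. \<xi> \<notin> lie_algebra \<G> G \<longrightarrow> l \<xi> = 0)}"

text \<open>The dual of the Lie algebra as a manifold. Each chart \<open>c\<close> of the group around the neutral
  element yields a global linear chart with values in the dual of the model space; the topology is
  that of pointwise convergence.\<close>

definition lie_dual_chart ::
  "'g monoid \<Rightarrow> ('g, 'h::real_normed_vector) manifold \<Rightarrow> ('g, 'h) chart \<Rightarrow>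
   (('g, 'h) tangent \<Rightarrow> real, 'h \<Rightarrow>\<^sub>L real) chart"
  where
  "lie_dual_chart \<G> G c =
     (lie_dual \<G> G, \<lambda>l. Blinfun (\<lambda>w. l (tangent_of_coord G \<one>\<^bsub>\<G>\<^esub> c w)))"

definition lie_dual_manifold ::
  "'g monoid \<Rightarrow> ('g, 'h::real_normed_vector) manifold \<Rightarrow>
   (('g, 'h) tangent \<Rightarrow> real, 'h \<Rightarrow>\<^sub>L real) manifold"
  where
  "lie_dual_manifold \<G> G =
     \<lparr>mtop = top_of_set (lie_dual \<G> G), atlas = lie_dual_chart \<G> G ` charts_at G \<one>\<^bsub>\<G>\<^esub>\<rparr>"

text \<open>The pairing of a tangent vector of the dual with an element \<open>\<xi>\<close> of the Lie algebra, under
  the canonical identification of the tangent spaces of a vector space with the space itself.\<close>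

definition dual_pairing ::
  "'g monoid \<Rightarrow> ('g, 'h::real_normed_vector) manifold \<Rightarrow>
   (('g, 'h) tangent \<Rightarrow> real, 'h \<Rightarrow>\<^sub>L real) tangent \<Rightarrow> ('g, 'h) tangent \<Rightarrow> real"
  where
  "dual_pairing \<G> G w \<xi> =
     (let c = some_chart G \<one>\<^bsub>\<G>\<^esub> in blinfun_apply (w (lie_dual_chart \<G> G c)) (\<xi> c))"

definition symplectic_action ::
  "'g monoid \<Rightarrow> ('g, 'h::real_normed_vector) manifold \<Rightarrow> ('a, 'e::real_normed_vector) manifold \<Rightarrow>
   ('a, 'e) form2 \<Rightarrow> ('g \<Rightarrow> 'a \<Rightarrow> 'a) \<Rightarrow> bool"
  where
  "symplectic_action \<G> G M \<omega> \<rho> \<longleftrightarrow>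
     group_action \<G> (points M) \<rho> \<and>
     smooth_map (prod_manifold G M) M (\<lambda>(g, x). \<rho> g x) \<and>
     (\<forall>g\<in>carrier \<G>. symplectomorphism M \<omega> M \<omega> (\<rho> g))"

text \<open>\<open>X_\<xi>(x) = d/dt exp(t \<xi>) x\<close> at \<open>t = 0\<close>, which is the differential of the orbit map
  at the neutral element.\<close>

definition generated_vector_field ::
  "'g monoid \<Rightarrow> ('g, 'h::real_normed_vector) manifold \<Rightarrow> ('a, 'e::real_normed_vector) manifold \<Rightarrow>
   ('g \<Rightarrow> 'a \<Rightarrow> 'a) \<Rightarrow> ('g, 'h) tangent \<Rightarrow> 'a \<Rightarrow> ('a, 'e) tangent"
  where
  "generated_vector_field \<G> G M \<rho> \<xi> x = differential G M (\<lambda>g. \<rho> g x) \<one>\<^bsub>\<G>\<^esub> \<xi>"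

definition moment_map ::
  "'g monoid \<Rightarrow> ('g, 'h::real_normed_vector) manifold \<Rightarrow> ('a, 'e::real_normed_vector) manifold \<Rightarrow>
   ('a, 'e) form2 \<Rightarrow> ('g \<Rightarrow> 'a \<Rightarrow> 'a) \<Rightarrow> ('a \<Rightarrow> ('g, 'h) tangent \<Rightarrow> real) \<Rightarrow> bool"
  where
  "moment_map \<G> G M \<omega> \<rho> \<mu> \<longleftrightarrow>
     smooth_map M (lie_dual_manifold \<G> G) \<mu> \<and>
     (\<forall>x\<in>points M. \<forall>v\<in>tangent_space M x. \<forall>\<xi>\<in>lie_algebra \<G> G.
        dual_pairing \<G> G (differential M (lie_dual_manifold \<G> G) \<mu> x v) \<xi>
      = \<omega> x (generated_vector_field \<G> G M \<rho> \<xi> x) v) \<and>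
     (\<forall>g\<in>carrier \<G>. \<forall>x\<in>points M. \<forall>\<xi>\<in>lie_algebra \<G> G.
        \<mu> (\<rho> g x) \<xi> = \<mu> x (adjoint \<G> G (inv\<^bsub>\<G>\<^esub> g) \<xi>))"

definition hamiltonian_action ::
  "'g monoid \<Rightarrow> ('g, 'h::real_normed_vector) manifold \<Rightarrow> ('a, 'e::real_normed_vector) manifold \<Rightarrow>
   ('a, 'e) form2 \<Rightarrow> ('g \<Rightarrow> 'a \<Rightarrow> 'a) \<Rightarrow> bool"
  where
  "hamiltonian_action \<G> G M \<omega> \<rho> \<longleftrightarrow>
     symplectic_action \<G> G M \<omega> \<rho> \<and> (\<exists>\<mu>. moment_map \<G> G M \<omega> \<rho> \<mu>)"

end

theory Submission
  imports Defs
begin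

text \<open>Let \<open>\<mu> y = 0\<close> and \<open>x = pr (\<psi> y)\<close>, and write \<open>f \<circ> pr \<circ> \<psi> = h \<circ> \<mu>\<close>. The differential of \<open>h\<close> at \<open>0\<close>
  is evaluation at some \<open>\<xi>\<close> in the Lie algebra, so the moment map equation gives
  \<open>d(f \<circ> pr \<circ> \<psi>) = \<omega>t(X_\<xi>, \<cdot>)\<close> at \<open>y\<close>. Transporting this along \<open>\<psi>\<close> and testing on vectors tangent to the
  factor \<open>M\<close> yields \<open>df = \<omega>(Y, \<cdot>)\<close> at \<open>x\<close>, where \<open>Y\<close> is the image of \<open>\<xi>\<close> under the differential at the
  neutral element of the map \<open>g \<mapsto> pr (\<psi> (g y))\<close>. By equivariance this map takes values in \<open>X\<^sub>0\<close>, so a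
  symplectomorphism \<open>\<phi>\<close> fixing \<open>X\<^sub>0\<close> satisfies \<open>d\<phi> Y = Y\<close>, and then
  \<open>df(d\<phi> v) = \<omega>(d\<phi> Y, d\<phi> v) = \<omega>(Y, v) = df(v)\<close>.\<close>

section \<open>Finite-dimensional normed spaces\<close>

text \<open>Some ball of radius \<open>e\<close> around \<open>a\<close> misses the closed subspace.
  For nonzero \<open>t\<close>, dividing \<open>t *\<^sub>R a + z\<close> by \<open>t\<close> gives
  the difference of \<open>a\<close> and a point of that subspace, so its norm is at least
  \<open>e\<close>. The coefficient of \<open>a\<close> is thereby controlled by the norm of the
  whole vector.\<close>

lemma line_gap_closed_span:
  fixes a :: "'a::real_normed_vector"
  assumes "closed (span B)" and "a \<notin> span B"
  obtains e where "e > 0" and "\<And>t z. z \<in> span B \<Longrightarrow> e * \<bar>t\<bar> \<le> norm (t *\<^sub>R a + z)"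
proof -
  have "open (- span B)" "a \<in> - span B"
    using assms by auto
  then obtain e where e: "e > 0" "ball a e \<subseteq> - span B"
    using open_contains_ball by blast
  have "e * \<bar>t\<bar> \<le> norm (t *\<^sub>R a + z)" if z: "z \<in> span B" for t z
  proof (cases "t = 0")
    case False
    have "(- (1 / t)) *\<^sub>R z \<in> span B"
      using z by (rule span_scale)
    then have "(- (1 / t)) *\<^sub>R z \<notin> ball a e"
      using e(2) by blast
    then have "e \<le> norm (a - (- (1 / t)) *\<^sub>R z)"
      by (simp add: dist_norm)
    moreover have "t *\<^sub>R a + z = t *\<^sub>R (a - (- (1 / t)) *\<^sub>R z)"
      using False by (simp add: algebra_simps)
    ultimately show ?thesis
      by (metis norm_scaleR mult.commute mult_left_mono abs_ge_zero)
  qed simp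
  with e(1) that show thesis by blast
qed

text \<open>Induction on the spanning set. If the new vector \<open>a\<close> lies outside the
  complete, hence closed, span of \<open>B\<close>, the gap estimate forces the coefficients of
  \<open>a\<close> along a Cauchy sequence to be Cauchy. The remainders are then Cauchy in
  \<open>span B\<close>, and both limits add up.\<close>

lemma complete_span_finite:
  fixes B :: "'a::real_normed_vector set"
  assumes "finite B"
  shows "complete (span B)"
  using assms
proof induction
  case empty
  then show ?case by (simp add: compact_imp_complete)
next
  case (insert a B)
  show ?case
  proof (cases "a \<in> span B")
    case True
    then show ?thesis using insert.IH by (simp add: span_redundant)
  next
    case False
    obtain e where e: "e > 0" and gap: "\<And>t z. z \<in> span B \<Longrightarrow> e * \<bar>t\<bar> \<le> norm (t *\<^sub>R a + z)"
      using line_gap_closed_span[OF complete_imp_closed[OF insert.IH] False] by blast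
    show ?thesis
      unfolding complete_def
    proof (intro allI impI)
      fix s :: "nat \<Rightarrow> 'a"
      assume "(\<forall>n. s n \<in> span (insert a B)) \<and> Cauchy s"
      then have s: "\<And>n. s n \<in> span (insert a B)" and cs: "Cauchy s" by auto
      have "\<forall>n. \<exists>k. s n - k *\<^sub>R a \<in> span B"
        using s span_breakdown_eq by blast
      then obtain t where t: "\<And>n. s n - t n *\<^sub>R a \<in> span B" by metis
      have le: "e * \<bar>t m - t n\<bar> \<le> norm (s m - s n)" for m n
      proof -
        have "(s m - t m *\<^sub>R a) - (s n - t n *\<^sub>R a) \<in> span B"
          by (rule span_diff[OF t t])
        from gap[OF this, of "t m - t n"] show ?thesis
          by (simp add: algebra_simps)
      qed
      have "Cauchy t"
      proof (rule CauchyI)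
        \<comment> \<open>The tolerance \<open>e * r\<close> for \<open>s\<close> becomes the
          tolerance \<open>r\<close> for the coefficients, by \<open>le\<close>.\<close>
        fix r :: real assume "r > 0"
        with e cs obtain N where N: "\<forall>m\<ge>N. \<forall>n\<ge>N. norm (s m - s n) < e * r"
          using CauchyD[of s "e * r"] by auto
        have "norm (t m - t n) < r" if "m \<ge> N" "n \<ge> N" for m n
        proof -
          have "e * \<bar>t m - t n\<bar> < e * r"
            using le[of m n] N that by fastforce
          then show ?thesis using e by simp
        qed
        then show "\<exists>M. \<forall>m\<ge>M. \<forall>n\<ge>M. norm (t m - t n) < r" by blast
      qed
      then obtain t0 where t0: "t \<longlonglongrightarrow> t0"
        using Cauchy_convergent convergent_def by blast
      then have ta: "(\<lambda>n. t n *\<^sub>R a) \<longlonglongrightarrow> t0 *\<^sub>R a"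
        by (intro tendsto_intros)
      have "Cauchy (\<lambda>n. s n - t n *\<^sub>R a)"
      proof (rule CauchyI)
        fix r :: real assume r: "r > 0"
        obtain N1 where N1: "\<forall>m\<ge>N1. \<forall>n\<ge>N1. norm (s m - s n) < r / 2"
          using CauchyD[OF cs, of "r / 2"] r by auto
        obtain N2 where N2: "\<forall>m\<ge>N2. \<forall>n\<ge>N2. norm (t m *\<^sub>R a - t n *\<^sub>R a) < r / 2"
          using CauchyD[OF LIMSEQ_imp_Cauchy[OF ta], of "r / 2"] r by auto
        have "norm ((s m - t m *\<^sub>R a) - (s n - t n *\<^sub>R a)) < r"
          if "m \<ge> max N1 N2" "n \<ge> max N1 N2" for m n
        proof -
          have "norm (s m - s n) < r / 2" "norm (t m *\<^sub>R a - t n *\<^sub>R a) < r / 2"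
            using N1 N2 that by simp_all
          with norm_triangle_ineq4[of "s m - s n" "t m *\<^sub>R a - t n *\<^sub>R a"]
          have "norm ((s m - s n) - (t m *\<^sub>R a - t n *\<^sub>R a)) < r" by linarith
          then show ?thesis by (simp add: algebra_simps)
        qed
        then show "\<exists>M. \<forall>m\<ge>M. \<forall>n\<ge>M. norm ((s m - t m *\<^sub>R a) - (s n - t n *\<^sub>R a)) < r"
          by blast
      qed
      then have "\<exists>l\<in>span B. (\<lambda>n. s n - t n *\<^sub>R a) \<longlonglongrightarrow> l"
        using insert.IH[unfolded complete_def, THEN spec, of "\<lambda>n. s n - t n *\<^sub>R a"] t by simp
      then obtain z where z: "z \<in> span B" "(\<lambda>n. s n - t n *\<^sub>R a) \<longlonglongrightarrow> z" by blast
      have "s \<longlonglongrightarrow> z + t0 *\<^sub>R a"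
        using tendsto_add[OF z(2) ta] by simp
      moreover have "z + t0 *\<^sub>R a \<in> span (insert a B)"
        using z(1) by (auto simp: span_breakdown_eq intro!: exI[of _ t0])
      ultimately show "\<exists>l\<in>span (insert a B). s \<longlonglongrightarrow> l" by blast
    qed
  qed
qed

text \<open>Split \<open>y\<close> into a multiple of \<open>a\<close> and a remainder in
  \<open>span B\<close>. The gap estimate bounds the coefficient by \<open>norm y / e\<close>, hence
  also the remainder, to which the induction hypothesis applies.\<close>

lemma linear_bounded_on_span_finite:
  fixes f :: "'a::real_normed_vector \<Rightarrow> 'b::real_normed_vector"
  assumes "finite B" and f: "linear f"
  shows "\<exists>K\<ge>0. \<forall>y\<in>span B. norm (f y) \<le> K * norm y"
  using assms(1)
proof induction
  case empty
  then show ?case using f by (auto simp: linear_0)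
next
  case (insert a B)
  show ?case
  proof (cases "a \<in> span B")
    case True
    then show ?thesis using insert.IH by (simp add: span_redundant)
  next
    case False
    obtain e where e: "e > 0" and gap: "\<And>t z. z \<in> span B \<Longrightarrow> e * \<bar>t\<bar> \<le> norm (t *\<^sub>R a + z)"
      using line_gap_closed_span[OF complete_imp_closed[OF complete_span_finite[OF insert.hyps(1)]] False]
      by blast
    obtain K where K: "K \<ge> 0" "\<And>y. y \<in> span B \<Longrightarrow> norm (f y) \<le> K * norm y"
      using insert.IH by blast
    \<comment> \<open>The first summand bounds the contribution of the multiple of \<open>a\<close>,
      the second that of the remainder, whose norm is at most
      \<open>(1 + norm a / e) * norm y\<close>.\<close>
    define C where "C = norm (f a) / e + K * (1 + norm a / e)"
    have "norm (f y) \<le> C * norm y" if y: "y \<in> span (insert a B)" for y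
    proof -
      obtain t where t: "y - t *\<^sub>R a \<in> span B"
        using y by (auto simp: span_breakdown_eq)
      have "e * \<bar>t\<bar> \<le> norm y"
        using gap[OF t, of t] by simp
      then have tb: "\<bar>t\<bar> \<le> norm y / e"
        using e by (simp add: field_simps)
      have "norm (y - t *\<^sub>R a) \<le> norm y + \<bar>t\<bar> * norm a"
        using norm_triangle_ineq4[of y "t *\<^sub>R a"] by simp
      also have "\<dots> \<le> norm y + norm y / e * norm a"
        using mult_right_mono[OF tb norm_ge_zero] by simp
      finally have zb: "norm (y - t *\<^sub>R a) \<le> norm y + norm y / e * norm a" .
      have "f y = t *\<^sub>R f a + f (y - t *\<^sub>R a)"
        using f by (simp add: linear_diff linear_scale)
      then have "norm (f y) \<le> \<bar>t\<bar> * norm (f a) + norm (f (y - t *\<^sub>R a))"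
        by (metis norm_scaleR norm_triangle_ineq)
      also have "\<dots> \<le> norm y / e * norm (f a) + K * (norm y + norm y / e * norm a)"
        using tb zb K(2)[OF t] K(1)
        by (intro add_mono mult_right_mono order_trans[OF K(2)[OF t]] mult_left_mono) auto
      also have "\<dots> = C * norm y"
        by (simp add: C_def algebra_simps)
      finally show ?thesis .
    qed
    moreover have "C \<ge> 0"
      using e K(1) by (simp add: C_def)
    ultimately show ?thesis by blast
  qed
qed

text \<open>Model spaces are only known to have a finite spanning set. Boundedness is what makes
  \<open>Blinfun\<close> of a linear functional apply as that functional, both for the dual basis
  and for the charts of the dual.\<close>

lemma linear_imp_bounded_linear_finite_dim:
  fixes f :: "'a::real_normed_vector \<Rightarrow> 'b::real_normed_vector"
  assumes "finite B" and "span B = (UNIV :: 'a set)" and "linear f"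
  shows "bounded_linear f"
proof -
  obtain K where "\<forall>y. norm (f y) \<le> K * norm y"
    using linear_bounded_on_span_finite[OF assms(1,3)] assms(2) by auto
  then show ?thesis
    using assms(3) by (auto simp: bounded_linear_def bounded_linear_axioms_def linear_def mult.commute)
qed

text \<open>Each \<eta> is the sum of its values on a finite basis times the coordinate functionals
  of that basis. Applying \<open>L\<close> termwise exhibits the vector at which to
  evaluate.\<close>

lemma blinfun_functional_is_evaluation:
  fixes L :: "('h::real_normed_vector \<Rightarrow>\<^sub>L real) \<Rightarrow> real"
  assumes "\<exists>B::'h set. finite B \<and> span B = UNIV" and L: "linear L"
  shows "\<exists>a. \<forall>\<eta>. L \<eta> = blinfun_apply \<eta> a"
proof -
  obtain S :: "'h set" where S: "finite S" "span S = UNIV"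
    using assms(1) by blast
  obtain B where B: "B \<subseteq> S" "independent B" "S \<subseteq> span B"
    using maximal_independent_subset by blast
  have fB: "finite B" using B(1) S(1) finite_subset by blast
  have sB: "span B = UNIV"
    using B(3) S(2) by (metis span_mono span_span top.extremum_unique)
  \<comment> \<open>These are the coordinate functionals, that is, the basis dual to
    \<open>B\<close>.\<close>
  define e where "e b = Blinfun (\<lambda>v. representation B v b)" for b
  have e: "blinfun_apply (e b) v = representation B v b" for b v
  proof -
    have lin: "linear (\<lambda>v. representation B v b)"
      using B(2) sB by (intro linearI) (auto simp: representation_add representation_scale)
    show ?thesis
      unfolding e_def
      by (simp add: bounded_linear_Blinfun_apply[OF linear_imp_bounded_linear_finite_dim[OF fB sB lin]])
  qed
  have expand: "v = (\<Sum>b\<in>B. representation B v b *\<^sub>R b)" for v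
    using sum_representation_eq[OF B(2) _ fB subset_refl, of v] sB by simp
  have eq: "\<eta> = (\<Sum>b\<in>B. blinfun_apply \<eta> b *\<^sub>R e b)" for \<eta>
  proof (rule blinfun_eqI)
    fix v
    have "blinfun_apply \<eta> v = blinfun_apply \<eta> (\<Sum>b\<in>B. representation B v b *\<^sub>R b)"
      using expand[of v] by simp
    then show "blinfun_apply \<eta> v = blinfun_apply (\<Sum>b\<in>B. blinfun_apply \<eta> b *\<^sub>R e b) v"
      by (simp add: blinfun.bilinear_simps e mult.commute)
  qed
  have "L \<eta> = blinfun_apply \<eta> (\<Sum>b\<in>B. L (e b) *\<^sub>R b)" for \<eta>
  proof -
    have "L \<eta> = L (\<Sum>b\<in>B. blinfun_apply \<eta> b *\<^sub>R e b)"
      using eq[of \<eta>] by simp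
    also have "\<dots> = (\<Sum>b\<in>B. blinfun_apply \<eta> b * L (e b))"
      using L by (simp add: linear_sum linear_scale)
    finally show ?thesis
      by (simp add: blinfun.bilinear_simps mult.commute)
  qed
  then show ?thesis by blast
qed

section \<open>Chain rule in charts\<close>

text \<open>The argument only takes first derivatives. The two notions below keep just what the chain rule
  needs, so that smoothness of products, projections and slices never has to be established.\<close>

definition chart_space :: "('a, 'e::real_normed_vector) manifold \<Rightarrow> bool" where
  "chart_space M \<longleftrightarrow>
     (\<Union>c\<in>atlas M. fst c) = points M \<and>
     (\<forall>c\<in>atlas M. openin (mtop M) (fst c) \<and> inj_on (snd c) (fst c) \<and>
        (\<forall>V. openin (mtop M) V \<longrightarrow> open (snd c ` (V \<inter> fst c))))"

definition differentiable_map ::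
  "('a, 'e::real_normed_vector) manifold \<Rightarrow> ('b, 'f::real_normed_vector) manifold \<Rightarrow> ('a \<Rightarrow> 'b) \<Rightarrow> bool"
  where
  "differentiable_map M N F \<longleftrightarrow>
     continuous_map (mtop M) (mtop N) F \<and>
     (\<forall>c\<in>atlas M. \<forall>c'\<in>atlas N. \<forall>p\<in>fst c. F p \<in> fst c' \<longrightarrow>
        (snd c' \<circ> F \<circ> chart_inv c) differentiable (at (snd c p)))"

section \<open>From smoothness to the first-order notions\<close>

lemma smooth_on_imp_differentiable:
  "smooth_on S f \<Longrightarrow> x \<in> S \<Longrightarrow> f differentiable (at x)"
  unfolding smooth_on_def by (metis Ck_on.simps(2))

lemma smooth_map_imp_differentiable_map:
  assumes "smooth_map M N F"
  shows "differentiable_map M N F"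
  using assms unfolding smooth_map_def differentiable_map_def
  by (auto intro!: smooth_on_imp_differentiable)

lemma smooth_manifold_imp_chart_space:
  assumes "smooth_manifold M"
  shows "chart_space M"
proof -
  have "inj_on (snd c) (fst c)" "\<And>V. openin (mtop M) V \<Longrightarrow> open (snd c ` (V \<inter> fst c))"
    if "c \<in> atlas M" for c
  proof -
    have op: "openin (mtop M) (fst c)" "open (snd c ` fst c)"
      and hom: "homeomorphic_map (subtopology (mtop M) (fst c)) (top_of_set (snd c ` fst c)) (snd c)"
      using assms that unfolding smooth_manifold_def by blast+
    have "topspace (subtopology (mtop M) (fst c)) = fst c"
      using openin_subset[OF op(1)] by auto
    then show "inj_on (snd c) (fst c)"
      using homeomorphic_imp_injective_map[OF hom] by simp
    fix V assume "openin (mtop M) V"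
    then have "openin (subtopology (mtop M) (fst c)) (V \<inter> fst c)"
      by (auto simp: openin_subtopology)
    then have "openin (top_of_set (snd c ` fst c)) (snd c ` (V \<inter> fst c))"
      using homeomorphic_imp_open_map[OF hom] unfolding open_map_def by blast
    then show "open (snd c ` (V \<inter> fst c))"
      using op(2) openin_open_trans by blast
  qed
  then show ?thesis
    using assms unfolding chart_space_def smooth_manifold_def by blast
qed

text \<open>The identity read in two charts is their transition map. Derivatives of transition maps
  can thus be handled as derivatives of a differentiable map.\<close>

lemma smooth_manifold_differentiable_id:
  assumes "smooth_manifold M"
  shows "differentiable_map M M id"
  using assms unfolding smooth_manifold_def differentiable_map_def
  by (auto intro!: smooth_on_imp_differentiable)

lemma chart_inv_chart:
  assumes "chart_space M" and "c \<in> atlas M" and "p \<in> fst c"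
  shows "chart_inv c (snd c p) = p"
  using assms by (simp add: chart_inv_def chart_space_def)

lemma chart_subset_points:
  assumes "chart_space M" and "c \<in> atlas M" and "p \<in> fst c"
  shows "p \<in> points M"
  using assms unfolding chart_space_def by blast

lemma open_chart_image:
  assumes "chart_space M" and "c \<in> atlas M" and "openin (mtop M) V"
  shows "open (snd c ` (V \<inter> fst c))"
  using assms by (simp add: chart_space_def)

lemma open_chart_range:
  assumes "chart_space M" and "c \<in> atlas M"
  shows "open (snd c ` fst c)"
  using open_chart_image[OF assms, of "fst c"] assms by (simp add: chart_space_def)

lemma some_chart_in_charts_at:
  assumes "chart_space M" and "p \<in> points M"
  shows "some_chart M p \<in> charts_at M p"
proof -
  have "\<exists>c. c \<in> charts_at M p"
    using assms unfolding chart_space_def charts_at_def by blast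
  then show ?thesis
    unfolding some_chart_def by (rule someI_ex)
qed

text \<open>The ordinary chain rule, once the inserted pair \<open>chart_inv d\<close> and
  \<open>snd d\<close> cancels. This happens where \<open>F\<close> lands in the domain of
  \<open>d\<close>; continuity of \<open>F\<close> and openness of charts make that a neighbourhood
  of \<open>snd c p\<close>. \<open>K\<close> is left general so that it can be a further map read
  in a chart or a mere change of chart.\<close>

lemma has_derivative_chart_chain:
  fixes M :: "('a, 'e::real_normed_vector) manifold" and N :: "('b, 'f::real_normed_vector) manifold"
    and K :: "'b \<Rightarrow> 'k::real_normed_vector"
  assumes M: "chart_space M" and N: "chart_space N"
    and F: "continuous_map (mtop M) (mtop N) F"
    and c: "c \<in> charts_at M p" and d: "d \<in> charts_at N (F p)"
    and A: "((snd d \<circ> F \<circ> chart_inv c) has_derivative A) (at (snd c p))"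
    and B: "((K \<circ> chart_inv d) has_derivative B) (at (snd d (F p)))"
  shows "((K \<circ> F \<circ> chart_inv c) has_derivative (B \<circ> A)) (at (snd c p))"
proof -
  have c': "c \<in> atlas M" "p \<in> fst c" and d': "d \<in> atlas N" "F p \<in> fst d"
    using c d by (auto simp: charts_at_def)
  define V where "V = {q \<in> points M. F q \<in> fst d}"
  have "openin (mtop M) V"
    unfolding V_def using openin_continuous_map_preimage[OF F] d'(1) N by (simp add: chart_space_def)
  then have op: "open (snd c ` (V \<inter> fst c))"
    by (rule open_chart_image[OF M c'(1)])
  have mem: "snd c p \<in> snd c ` (V \<inter> fst c)"
    using c' d' chart_subset_points[OF M c'] by (auto simp: V_def)
  have eq: "((K \<circ> chart_inv d) \<circ> (snd d \<circ> F \<circ> chart_inv c)) y = (K \<circ> F \<circ> chart_inv c) y"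
    if "y \<in> snd c ` (V \<inter> fst c)" for y
  proof -
    obtain q where q: "y = snd c q" "q \<in> fst c" "F q \<in> fst d"
      using \<open>y \<in> _\<close> by (auto simp: V_def)
    then show ?thesis
      by (simp add: chart_inv_chart[OF M c'(1)] chart_inv_chart[OF N d'(1)])
  qed
  have "(((K \<circ> chart_inv d) \<circ> (snd d \<circ> F \<circ> chart_inv c)) has_derivative (B \<circ> A)) (at (snd c p))"
    using B by (intro diff_chain_at[OF A]) (simp add: chart_inv_chart[OF M c'])
  then show ?thesis
    by (rule has_derivative_transform_within_open[OF _ op mem]) (rule eq)
qed

section \<open>Calculus of differentials\<close>

lemma differentiable_map_has_derivative:
  assumes "differentiable_map M N F" and "c \<in> charts_at M p" and "d \<in> charts_at N (F p)"
  shows "((snd d \<circ> F \<circ> chart_inv c) has_derivative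
           frechet_derivative (snd d \<circ> F \<circ> chart_inv c) (at (snd c p))) (at (snd c p))"
  using assms unfolding differentiable_map_def charts_at_def
  by (simp add: frechet_derivative_works)

lemma differentiable_map_continuous:
  "differentiable_map M N F \<Longrightarrow> continuous_map (mtop M) (mtop N) F"
  by (simp add: differentiable_map_def)

lemma differentiable_map_in_points:
  "differentiable_map M N F \<Longrightarrow> p \<in> points M \<Longrightarrow> F p \<in> points N"
  unfolding differentiable_map_def continuous_map_def by blast

lemma differentiable_map_compose:
  assumes M: "chart_space M" and N: "chart_space N"
    and F: "differentiable_map M N F" and H: "differentiable_map N P H"
  shows "differentiable_map M P (H \<circ> F)"
  unfolding differentiable_map_def
proof (intro conjI ballI impI)
  show "continuous_map (mtop M) (mtop P) (H \<circ> F)"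
    using F H continuous_map_compose unfolding differentiable_map_def by blast
  fix c c' p assume c: "c \<in> atlas M" "p \<in> fst c" and c': "c' \<in> atlas P" "(H \<circ> F) p \<in> fst c'"
  then have cc: "c \<in> charts_at M p" "c' \<in> charts_at P (H (F p))"
    by (auto simp: charts_at_def)
  have "F p \<in> points N"
    using differentiable_map_in_points[OF F] chart_subset_points[OF M c] by blast
  then have d: "some_chart N (F p) \<in> charts_at N (F p)"
    by (rule some_chart_in_charts_at[OF N])
  have "((snd c' \<circ> H \<circ> F \<circ> chart_inv c) has_derivative
     frechet_derivative (snd c' \<circ> H \<circ> chart_inv (some_chart N (F p))) (at (snd (some_chart N (F p)) (F p)))
     \<circ> frechet_derivative (snd (some_chart N (F p)) \<circ> F \<circ> chart_inv c) (at (snd c p))) (at (snd c p))"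
    by (rule has_derivative_chart_chain[OF M N differentiable_map_continuous[OF F] cc(1) d
        differentiable_map_has_derivative[OF F cc(1) d] differentiable_map_has_derivative[OF H d cc(2)]])
  then show "(snd c' \<circ> (H \<circ> F) \<circ> chart_inv c) differentiable (at (snd c p))"
    unfolding differentiable_def by (auto simp: o_assoc)
qed

text \<open>The chain rule is taken through \<open>some_chart N (F p)\<close>, the very chart in
  which the outer differential reads its argument, so the two sides match without any change of
  chart.\<close>

lemma differential_compose:
  assumes M: "chart_space M" and N: "chart_space N"
    and F: "differentiable_map M N F" and H: "differentiable_map N P H" and p: "p \<in> points M"
  shows "differential M P (H \<circ> F) p v = differential N P H (F p) (differential M N F p v)"
proof
  fix c'
  have d: "some_chart N (F p) \<in> charts_at N (F p)"
    using some_chart_in_charts_at[OF N] differentiable_map_in_points[OF F p] by blast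
  have c: "some_chart M p \<in> charts_at M p"
    using some_chart_in_charts_at[OF M p] .
  show "differential M P (H \<circ> F) p v c' = differential N P H (F p) (differential M N F p v) c'"
  proof (cases "c' \<in> charts_at P (H (F p))")
    case True
    have "((snd c' \<circ> H \<circ> F \<circ> chart_inv (some_chart M p)) has_derivative
     frechet_derivative (snd c' \<circ> H \<circ> chart_inv (some_chart N (F p))) (at (snd (some_chart N (F p)) (F p)))
     \<circ> frechet_derivative (snd (some_chart N (F p)) \<circ> F \<circ> chart_inv (some_chart M p))
         (at (snd (some_chart M p) p))) (at (snd (some_chart M p) p))"
      by (rule has_derivative_chart_chain[OF M N differentiable_map_continuous[OF F] c d
        differentiable_map_has_derivative[OF F c d] differentiable_map_has_derivative[OF H d True]])
    from frechet_derivative_at[OF this, symmetric] show ?thesis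
      using True d by (simp add: differential_def o_assoc)
  next
    case False
    then show ?thesis by (simp add: differential_def)
  qed
qed

text \<open>On the open range of a chart, \<open>chart_inv\<close> returns points of
  \<open>M\<close>, so both maps have the same coordinate expression there. Agreement is asked only
  on \<open>points M\<close> because a total function is arbitrary elsewhere.\<close>

lemma differential_cong:
  assumes M: "chart_space M" and p: "p \<in> points M" and F: "differentiable_map M N F"
    and eq: "\<And>q. q \<in> points M \<Longrightarrow> F q = F' q"
  shows "differential M N F p v = differential M N F' p v"
proof
  fix c'
  define c where "c = some_chart M p"
  have cc: "c \<in> charts_at M p"
    unfolding c_def using some_chart_in_charts_at[OF M p] .
  then have c: "c \<in> atlas M" "p \<in> fst c" by (auto simp: charts_at_def)
  have op: "open (snd c ` fst c)"
    using open_chart_range[OF M c(1)] .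
  have "frechet_derivative (snd c' \<circ> F \<circ> chart_inv c) (at (snd c p)) =
        frechet_derivative (snd c' \<circ> F' \<circ> chart_inv c) (at (snd c p))"
    if "c' \<in> charts_at N (F p)"
  proof (rule frechet_derivative_transform_within_open[OF _ op])
    show "(snd c' \<circ> F \<circ> chart_inv c) differentiable (at (snd c p))"
      using differentiable_map_has_derivative[OF F cc that] differentiable_def by blast
    show "snd c p \<in> snd c ` fst c" using c by blast
  qed (use eq chart_subset_points[OF M c(1)] in \<open>auto simp: chart_inv_chart[OF M c(1)]\<close>)
  then show "differential M N F p v c' = differential M N F' p v c'"
    using eq[OF p] by (simp add: differential_def c_def)
qed

text \<open>Changing the target chart composes the coordinate expression of \<open>F\<close> with a
  transition map, so the chain rule gives the required compatibility. It holds for every family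
  \<open>v\<close>, since only the coordinate in one chart enters.\<close>

lemma differential_in_tangent_space:
  assumes M: "chart_space M" and N: "smooth_manifold N"
    and F: "differentiable_map M N F" and p: "p \<in> points M"
  shows "differential M N F p v \<in> tangent_space N (F p)"
proof -
  define c where "c = some_chart M p"
  have c: "c \<in> charts_at M p"
    unfolding c_def using some_chart_in_charts_at[OF M p] .
  have "differential M N F p v d' = transition_deriv d d' (F p) (differential M N F p v d)"
    if d: "d \<in> charts_at N (F p)" and d': "d' \<in> charts_at N (F p)" for d d'
  proof -
    have D: "((snd d' \<circ> chart_inv d) has_derivative
        frechet_derivative (snd d' \<circ> chart_inv d) (at (snd d (F p)))) (at (snd d (F p)))"
      using differentiable_map_has_derivative[OF smooth_manifold_differentiable_id[OF N] d, of d'] d'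
      by simp
    have "((snd d' \<circ> F \<circ> chart_inv c) has_derivative
        frechet_derivative (snd d' \<circ> chart_inv d) (at (snd d (F p)))
      \<circ> frechet_derivative (snd d \<circ> F \<circ> chart_inv c) (at (snd c p))) (at (snd c p))"
      by (rule has_derivative_chart_chain[OF M smooth_manifold_imp_chart_space[OF N]
        differentiable_map_continuous[OF F] c d differentiable_map_has_derivative[OF F c d] D])
    from frechet_derivative_at[OF this, symmetric] show ?thesis
      using d d' by (simp add: differential_def transition_deriv_def flip: c_def)
  qed
  moreover have "differential M N F p v d = 0" if "d \<notin> charts_at N (F p)" for d
    using that by (simp add: differential_def)
  ultimately show ?thesis
    unfolding tangent_space_def by blast
qed

text \<open>The derivative of the identity from the chosen chart to \<open>c'\<close> is the
  transition derivative, and the coordinates of a tangent vector are related by exactly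
  these.\<close>

lemma differential_id:
  assumes M: "chart_space M" and p: "p \<in> points M" and v: "v \<in> tangent_space M p"
  shows "differential M M id p v = v"
proof
  fix c'
  show "differential M M id p v c' = v c'"
  proof (cases "c' \<in> charts_at M p")
    case True
    then have "v c' = transition_deriv (some_chart M p) c' p (v (some_chart M p))"
      using v some_chart_in_charts_at[OF M p] unfolding tangent_space_def by blast
    then show ?thesis
      using True by (simp add: differential_def transition_deriv_def)
  next
    case False
    then have "v c' = 0"
      using v unfolding tangent_space_def by blast
    then show ?thesis
      using False by (simp add: differential_def)
  qed
qed

lemma differential_const: "differential M N (\<lambda>_. b) p v = (\<lambda>_. 0)"
  by (auto simp: differential_def comp_def)

section \<open>Products\<close>

lemma chart_inv_prod:
  assumes "inj_on (snd c) (fst c)" "inj_on (snd d) (fst d)"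
    and "a \<in> snd c ` fst c" "b \<in> snd d ` fst d"
  shows "chart_inv (fst c \<times> fst d, map_prod (snd c) (snd d)) (a, b) = (chart_inv c a, chart_inv d b)"
proof -
  obtain p q where p: "p \<in> fst c" "a = snd c p" and q: "q \<in> fst d" "b = snd d q"
    using assms(3,4) by blast
  have "inv_into (fst c \<times> fst d) (map_prod (snd c) (snd d)) (a, b) = (p, q)"
    using p q by (intro inv_into_f_eq map_prod_inj_on[OF assms(1,2)]) auto
  then show ?thesis
    using p q assms(1,2) by (simp add: chart_inv_def)
qed

text \<open>Every point of an open set of the product has an open box around it, and a product chart
  maps a box to the product of two open images.\<close>

lemma chart_space_prod:
  assumes M: "chart_space M" and N: "chart_space N"
  shows "chart_space (prod_manifold M N)"
proof -
  have open_img: "open (map_prod (snd c) (snd d) ` (W \<inter> fst c \<times> fst d))"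
    if c: "c \<in> atlas M" and d: "d \<in> atlas N" and W: "openin (prod_topology (mtop M) (mtop N)) W"
    for c d W
  proof (subst open_subopen, intro ballI)
    fix y assume "y \<in> map_prod (snd c) (snd d) ` (W \<inter> fst c \<times> fst d)"
    then obtain p q where pq: "y = (snd c p, snd d q)" "(p, q) \<in> W" "p \<in> fst c" "q \<in> fst d" by auto
    obtain U V where UV: "openin (mtop M) U" "openin (mtop N) V" "p \<in> U" "q \<in> V" "U \<times> V \<subseteq> W"
      using W[unfolded openin_prod_topology_alt, rule_format, OF pq(2)] by blast
    have "open (snd c ` (U \<inter> fst c) \<times> snd d ` (V \<inter> fst d))"
      using open_chart_image[OF M c UV(1)] open_chart_image[OF N d UV(2)] by (rule open_Times)
    moreover have "y \<in> snd c ` (U \<inter> fst c) \<times> snd d ` (V \<inter> fst d)"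
      using pq UV by blast
    moreover have "snd c ` (U \<inter> fst c) \<times> snd d ` (V \<inter> fst d)
        \<subseteq> map_prod (snd c) (snd d) ` (W \<inter> fst c \<times> fst d)"
    proof
      fix z assume "z \<in> snd c ` (U \<inter> fst c) \<times> snd d ` (V \<inter> fst d)"
      then obtain p' q' where "z = map_prod (snd c) (snd d) (p', q')"
        "(p', q') \<in> U \<times> V" "(p', q') \<in> fst c \<times> fst d" by auto
      then show "z \<in> map_prod (snd c) (snd d) ` (W \<inter> fst c \<times> fst d)"
        using UV(5) by blast
    qed
    ultimately show "\<exists>T. open T \<and> y \<in> T \<and> T \<subseteq> map_prod (snd c) (snd d) ` (W \<inter> fst c \<times> fst d)"
      by blast
  qed
  have cover: "(\<Union>c\<in>atlas (prod_manifold M N). fst c) = (\<Union>c\<in>atlas M. fst c) \<times> (\<Union>d\<in>atlas N. fst d)"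
    unfolding prod_manifold_def by force
  have "openin (prod_topology (mtop M) (mtop N)) (fst c \<times> fst d)"
       "inj_on (map_prod (snd c) (snd d)) (fst c \<times> fst d)"
    if "c \<in> atlas M" "d \<in> atlas N" for c d
    using M N that unfolding chart_space_def by (auto intro: map_prod_inj_on simp: openin_prod_Times_iff)
  then show ?thesis
    using M N open_img unfolding chart_space_def cover
    by (auto simp: prod_manifold_def)
qed

lemma prod_chart_cases:
  assumes "c \<in> atlas (prod_manifold M N)"
  obtains a b where "a \<in> atlas M" "b \<in> atlas N" "c = (fst a \<times> fst b, map_prod (snd a) (snd b))"
  using assms by (auto simp: prod_manifold_def)

text \<open>In a product chart the projection is a transition map of \<open>M\<close> after the
  linear projection of the model spaces; the product of the chart ranges is an open set on which
  this identity holds.\<close>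

lemma differentiable_map_fst:
  assumes M: "smooth_manifold M" and N: "chart_space N"
  shows "differentiable_map (prod_manifold M N) M fst"
  unfolding differentiable_map_def
proof (intro conjI ballI impI)
  show "continuous_map (mtop (prod_manifold M N)) (mtop M) fst"
    by (simp add: prod_manifold_def continuous_map_fst)
  fix c c' p
  assume c0: "c \<in> atlas (prod_manifold M N)" and p: "p \<in> fst c"
    and c': "c' \<in> atlas M" "fst p \<in> fst c'"
  obtain a b where ab: "a \<in> atlas M" "b \<in> atlas N"
    and c: "c = (fst a \<times> fst b, map_prod (snd a) (snd b))"
    by (rule prod_chart_cases[OF c0])
  have M': "chart_space M" using smooth_manifold_imp_chart_space[OF M] .
  have pa: "fst p \<in> fst a" "snd p \<in> fst b" using p c by auto
  have inj: "inj_on (snd a) (fst a)" "inj_on (snd b) (fst b)"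
    using M' N ab unfolding chart_space_def by blast+
  have op: "open (snd a ` fst a \<times> snd b ` fst b)"
    using M' N ab by (intro open_Times open_chart_range)
  have "(snd c' \<circ> chart_inv a) differentiable (at (snd a (fst p)))"
    using differentiable_map_has_derivative[OF smooth_manifold_differentiable_id[OF M], of a "fst p" c'] ab(1) c' pa(1)
    by (auto simp: charts_at_def differentiable_def)
  then obtain D where "((snd c' \<circ> chart_inv a) has_derivative D) (at (snd a (fst p)))"
    by (auto simp: differentiable_def)
  then have "(((snd c' \<circ> chart_inv a) \<circ> fst) has_derivative (D \<circ> fst)) (at (snd c p))"
    by (intro diff_chain_at has_derivative_fst has_derivative_ident) (auto simp: c)
  then have "((snd c' \<circ> fst \<circ> chart_inv c) has_derivative (D \<circ> fst)) (at (snd c p))"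
  proof (rule has_derivative_transform_within_open[OF _ op])
    show "snd c p \<in> snd a ` fst a \<times> snd b ` fst b"
      using pa c by (auto simp: map_prod_def split_beta)
    show "((snd c' \<circ> chart_inv a) \<circ> fst) y = (snd c' \<circ> fst \<circ> chart_inv c) y"
      if "y \<in> snd a ` fst a \<times> snd b ` fst b" for y
      using that chart_inv_prod[OF inj, of "fst y" "snd y"] unfolding c by auto
  qed
  then show "(snd c' \<circ> fst \<circ> chart_inv c) differentiable (at (snd c p))"
    by (auto simp: differentiable_def)
qed

lemma differentiable_map_snd:
  assumes M: "chart_space M" and N: "smooth_manifold N"
  shows "differentiable_map (prod_manifold M N) N snd"
  unfolding differentiable_map_def
proof (intro conjI ballI impI)
  show "continuous_map (mtop (prod_manifold M N)) (mtop N) snd"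
    by (simp add: prod_manifold_def continuous_map_snd)
  fix c c' p
  assume c0: "c \<in> atlas (prod_manifold M N)" and p: "p \<in> fst c"
    and c': "c' \<in> atlas N" "snd p \<in> fst c'"
  obtain a b where ab: "a \<in> atlas M" "b \<in> atlas N"
    and c: "c = (fst a \<times> fst b, map_prod (snd a) (snd b))"
    by (rule prod_chart_cases[OF c0])
  have N': "chart_space N" using smooth_manifold_imp_chart_space[OF N] .
  have pa: "fst p \<in> fst a" "snd p \<in> fst b" using p c by auto
  have inj: "inj_on (snd a) (fst a)" "inj_on (snd b) (fst b)"
    using M N' ab unfolding chart_space_def by blast+
  have op: "open (snd a ` fst a \<times> snd b ` fst b)"
    using M N' ab by (intro open_Times open_chart_range)
  have "(snd c' \<circ> chart_inv b) differentiable (at (snd b (snd p)))"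
    using differentiable_map_has_derivative[OF smooth_manifold_differentiable_id[OF N], of b "snd p" c'] ab(2) c' pa(2)
    by (auto simp: charts_at_def differentiable_def)
  then obtain D where "((snd c' \<circ> chart_inv b) has_derivative D) (at (snd b (snd p)))"
    by (auto simp: differentiable_def)
  then have "(((snd c' \<circ> chart_inv b) \<circ> snd) has_derivative (D \<circ> snd)) (at (snd c p))"
    by (intro diff_chain_at has_derivative_snd has_derivative_ident) (auto simp: c)
  then have "((snd c' \<circ> snd \<circ> chart_inv c) has_derivative (D \<circ> snd)) (at (snd c p))"
  proof (rule has_derivative_transform_within_open[OF _ op])
    show "snd c p \<in> snd a ` fst a \<times> snd b ` fst b"
      using pa c by (auto simp: map_prod_def split_beta)
    show "((snd c' \<circ> chart_inv b) \<circ> snd) y = (snd c' \<circ> snd \<circ> chart_inv c) y"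
      if "y \<in> snd a ` fst a \<times> snd b ` fst b" for y
      using that chart_inv_prod[OF inj, of "fst y" "snd y"] unfolding c by auto
  qed
  then show "(snd c' \<circ> snd \<circ> chart_inv c) differentiable (at (snd c p))"
    by (auto simp: differentiable_def)
qed

text \<open>In charts the slice pairs a transition map of \<open>M\<close> with a constant. It
  serves both for orbit maps and for lifting vectors from one factor of a product.\<close>

lemma differentiable_map_slice:
  assumes M: "smooth_manifold M" and b: "b \<in> points N"
  shows "differentiable_map M (prod_manifold M N) (\<lambda>x. (x, b))"
  unfolding differentiable_map_def
proof (intro conjI ballI impI)
  show "continuous_map (mtop M) (mtop (prod_manifold M N)) (\<lambda>x. (x, b))"
    using b by (simp add: prod_manifold_def continuous_map_pairedI)
  fix c c' p assume c: "c \<in> atlas M" "p \<in> fst c"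
    and c': "c' \<in> atlas (prod_manifold M N)" and pb: "(p, b) \<in> fst c'"
  obtain a d where "a \<in> atlas M" and eq: "c' = (fst a \<times> fst d, map_prod (snd a) (snd d))"
    by (rule prod_chart_cases[OF c'])
  then have a: "a \<in> atlas M" "p \<in> fst a"
    using pb by auto
  have "(snd a \<circ> chart_inv c) differentiable (at (snd c p))"
    using differentiable_map_has_derivative[OF smooth_manifold_differentiable_id[OF M], of c p a] a c
    by (auto simp: charts_at_def differentiable_def)
  then have "(\<lambda>y. (snd a (chart_inv c y), snd d b)) differentiable (at (snd c p))"
    unfolding differentiable_def comp_def using has_derivative_Pair[OF _ has_derivative_const] by blast
  then show "(snd c' \<circ> (\<lambda>x. (x, b)) \<circ> chart_inv c) differentiable (at (snd c p))"
    by (simp add: eq comp_def)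
qed

section \<open>Coordinates of tangent vectors and the dual of the Lie algebra\<close>

lemma linear_transition_deriv:
  assumes M: "smooth_manifold M" and c: "c \<in> charts_at M p" and c': "c' \<in> charts_at M p"
  shows "linear (transition_deriv c c' p)"
proof -
  have "((snd c' \<circ> chart_inv c) has_derivative transition_deriv c c' p) (at (snd c p))"
    using differentiable_map_has_derivative[OF smooth_manifold_differentiable_id[OF M] c, of c'] c'
    by (simp add: transition_deriv_def)
  then show ?thesis
    by (rule has_derivative_linear)
qed

text \<open>The cocycle rule is the chart chain rule for the identity map. It makes the family built
  by \<open>tangent_of_coord\<close> a tangent vector.\<close>

lemma transition_deriv_trans:
  assumes M: "smooth_manifold M"
    and c: "c \<in> charts_at M p" and d: "d \<in> charts_at M p" and d': "d' \<in> charts_at M p"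
  shows "transition_deriv c d' p w = transition_deriv d d' p (transition_deriv c d p w)"
proof -
  have id: "differentiable_map M M id"
    using smooth_manifold_differentiable_id[OF M] .
  have M': "chart_space M"
    using smooth_manifold_imp_chart_space[OF M] .
  have D: "((snd b \<circ> chart_inv a) has_derivative transition_deriv a b p) (at (snd a p))"
    if "a \<in> charts_at M p" "b \<in> charts_at M p" for a b
    using differentiable_map_has_derivative[OF id that(1), of b] that(2)
    by (simp add: transition_deriv_def)
  have "((snd d' \<circ> id \<circ> chart_inv c) has_derivative (transition_deriv d d' p \<circ> transition_deriv c d p))
      (at (snd c p))"
    using has_derivative_chart_chain[OF M' M' differentiable_map_continuous[OF id] c _ _ , of d] d
      D[OF c d] D[OF d d'] by simp
  from frechet_derivative_at[OF this, symmetric] show ?thesis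
    by (simp add: transition_deriv_def)
qed

lemma tangent_of_coord_in_tangent_space:
  assumes M: "smooth_manifold M" and c: "c \<in> charts_at M p"
  shows "tangent_of_coord M p c w \<in> tangent_space M p"
  unfolding tangent_space_def
proof (intro CollectI conjI ballI allI impI)
  fix d d' assume d: "d \<in> charts_at M p" and d': "d' \<in> charts_at M p"
  show "tangent_of_coord M p c w d' = transition_deriv d d' p (tangent_of_coord M p c w d)"
    using transition_deriv_trans[OF M c d d', of w] d d' by (simp add: tangent_of_coord_def)
qed (simp add: tangent_of_coord_def)

lemma tangent_of_coord_coord:
  assumes c: "c \<in> charts_at M p" and v: "v \<in> tangent_space M p"
  shows "tangent_of_coord M p c (v c) = v"
proof
  fix c'
  show "tangent_of_coord M p c (v c) c' = v c'"
    using c v unfolding tangent_space_def tangent_of_coord_def mem_Collect_eq by metis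
qed

lemma tangent_of_coord_same_chart:
  assumes M: "chart_space M" and c: "c \<in> charts_at M p"
  shows "tangent_of_coord M p c w c = w"
proof -
  have c': "c \<in> atlas M" "p \<in> fst c" using c by (auto simp: charts_at_def)
  have "((snd c \<circ> chart_inv c) has_derivative (\<lambda>h. h)) (at (snd c p))"
    by (rule has_derivative_transform_within_open[OF has_derivative_ident open_chart_range[OF M c'(1)]])
      (use c' chart_inv_chart[OF M c'(1)] in auto)
  from frechet_derivative_at[OF this, symmetric] show ?thesis
    using c by (simp add: tangent_of_coord_def transition_deriv_def)
qed

text \<open>Transition derivatives are linear, so coordinate vectors combine in every chart as they
  do in \<open>c\<close>; linearity on the tangent space then passes to the model space.\<close>

lemma linear_functional_of_coord:
  assumes M: "smooth_manifold M" and c: "c \<in> charts_at M p" and l: "linear_on_tangent M p l"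
  shows "linear (\<lambda>w. l (tangent_of_coord M p c w))"
proof -
  have comb: "tangent_of_coord M p c (a *\<^sub>R x + b *\<^sub>R y)
      = (\<lambda>c'. a *\<^sub>R tangent_of_coord M p c x c' + b *\<^sub>R tangent_of_coord M p c y c')" for a b x y
  proof
    fix c'
    show "tangent_of_coord M p c (a *\<^sub>R x + b *\<^sub>R y) c'
      = a *\<^sub>R tangent_of_coord M p c x c' + b *\<^sub>R tangent_of_coord M p c y c'"
      using linear_transition_deriv[OF M c]
      by (auto simp: tangent_of_coord_def linear_add linear_scale)
  qed
  have lin: "l (tangent_of_coord M p c (a *\<^sub>R x + b *\<^sub>R y))
      = a * l (tangent_of_coord M p c x) + b * l (tangent_of_coord M p c y)" for a b x y
    unfolding comb using l tangent_of_coord_in_tangent_space[OF M c]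
    unfolding linear_on_tangent_def by blast
  show ?thesis
    \<comment> \<open>Coefficients 1 and 1 give additivity; a second coefficient 0 gives
      homogeneity.\<close>
    using lin[of 1 _ 1] lin[of _ _ 0] by (intro linearI) simp_all
qed

text \<open>A functional in \<open>lie_dual\<close> is fixed by its values on the Lie algebra, since
  it is 0 elsewhere, and every element of the Lie algebra is recovered from its coordinate in
  \<open>c\<close>. This lets \<open>chart_inv\<close> undo the chart.\<close>

lemma inj_on_lie_dual_chart:
  assumes G: "lie_group \<G> G" and c: "c \<in> charts_at G \<one>\<^bsub>\<G>\<^esub>"
  shows "inj_on (snd (lie_dual_chart \<G> G c)) (lie_dual \<G> G)"
proof (rule inj_onI)
  fix l l'
  assume l: "l \<in> lie_dual \<G> G" and l': "l' \<in> lie_dual \<G> G"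
    and eq: "snd (lie_dual_chart \<G> G c) l = snd (lie_dual_chart \<G> G c) l'"
  have G': "smooth_manifold G" using G by (simp add: lie_group_def)
  obtain B :: "'b set" where B: "finite B" "span B = UNIV"
    using G' unfolding smooth_manifold_def by blast
  have app: "blinfun_apply (snd (lie_dual_chart \<G> G c) k) = (\<lambda>w. k (tangent_of_coord G \<one>\<^bsub>\<G>\<^esub> c w))"
    if "k \<in> lie_dual \<G> G" for k
  proof -
    have lin: "linear (\<lambda>w. k (tangent_of_coord G \<one>\<^bsub>\<G>\<^esub> c w))"
      using linear_functional_of_coord[OF G' c] that by (simp add: lie_dual_def)
    show ?thesis
      using bounded_linear_Blinfun_apply[OF linear_imp_bounded_linear_finite_dim[OF B lin]]
      by (simp add: lie_dual_chart_def)
  qed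
  show "l = l'"
  proof
    fix \<xi>
    show "l \<xi> = l' \<xi>"
    proof (cases "\<xi> \<in> lie_algebra \<G> G")
      case True
      then have "tangent_of_coord G \<one>\<^bsub>\<G>\<^esub> c (\<xi> c) = \<xi>"
        using tangent_of_coord_coord[OF c] by (simp add: lie_algebra_def)
      then show ?thesis
        using fun_cong[OF app[OF l], of "\<xi> c"] fun_cong[OF app[OF l'], of "\<xi> c"] eq by simp
    next
      case False
      then show ?thesis using l l' by (simp add: lie_dual_def)
    qed
  qed
qed

lemma charts_at_real_line: "charts_at real_line y = {(UNIV, id)}"
  by (auto simp: charts_at_def real_line_def)

text \<open>Finite-dimensional reflexivity turns the differential of a function on the dual into an
  element of the Lie algebra.\<close>

lemma differential_through_moment_map:
  assumes G: "lie_group \<G> G" and X: "chart_space X" and x: "x \<in> points X"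
    and \<mu>: "differentiable_map X (lie_dual_manifold \<G> G) \<mu>"
    and h: "differentiable_map (lie_dual_manifold \<G> G) real_line h"
  shows "\<exists>\<xi>\<in>lie_algebra \<G> G. \<forall>v. ext_deriv X (h \<circ> \<mu>) x v
           = dual_pairing \<G> G (differential X (lie_dual_manifold \<G> G) \<mu> x v) \<xi>"
proof -
  have G': "smooth_manifold G" "chart_space G"
    using G smooth_manifold_imp_chart_space by (auto simp: lie_group_def)
  have "\<one>\<^bsub>\<G>\<^esub> \<in> points G"
    using G group.is_monoid monoid.one_closed unfolding lie_group_def by metis
  then have c: "some_chart G \<one>\<^bsub>\<G>\<^esub> \<in> charts_at G \<one>\<^bsub>\<G>\<^esub>"
    by (rule some_chart_in_charts_at[OF G'(2)])
  define c where "c = some_chart G \<one>\<^bsub>\<G>\<^esub>"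
  define k where "k = lie_dual_chart \<G> G c"
  define d where "d = some_chart X x"
  have d: "d \<in> charts_at X x" unfolding d_def by (rule some_chart_in_charts_at[OF X x])
  then have d': "d \<in> atlas X" "x \<in> fst d" by (auto simp: charts_at_def)
  have \<mu>_dual: "\<mu> y \<in> lie_dual \<G> G" if "y \<in> points X" for y
    using differentiable_map_in_points[OF \<mu> that] by (simp add: lie_dual_manifold_def)
  have k: "k \<in> charts_at (lie_dual_manifold \<G> G) (\<mu> x)"
    using c \<mu>_dual[OF x]
    by (auto simp: charts_at_def lie_dual_manifold_def k_def c_def lie_dual_chart_def)
  have k_inv: "chart_inv k (snd k l) = l" if "l \<in> lie_dual \<G> G" for l
  proof -
    have "fst k = lie_dual \<G> G"
      by (simp add: k_def lie_dual_chart_def)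
    then show ?thesis
      using inv_into_f_f[OF inj_on_lie_dual_chart[OF G c] that] by (simp add: chart_inv_def k_def c_def)
  qed
  define L where "L = frechet_derivative (h \<circ> chart_inv k) (at (snd k (\<mu> x)))"
  have L: "((h \<circ> chart_inv k) has_derivative L) (at (snd k (\<mu> x)))"
    using differentiable_map_has_derivative[OF h k, of "(UNIV, id)"]
    by (simp add: charts_at_real_line L_def)
  obtain a where a: "\<And>\<eta>. L \<eta> = blinfun_apply \<eta> a"
    using blinfun_functional_is_evaluation[OF _ has_derivative_linear[OF L]] G'(1)
    unfolding smooth_manifold_def by blast
  \<comment> \<open>The vector \<open>a\<close> is the coordinate of \<xi> in
    \<open>some_chart\<close> at the neutral element, the chart in which \<open>dual_pairing\<close>
    reads its arguments.\<close>
  define \<xi> where "\<xi> = tangent_of_coord G \<one>\<^bsub>\<G>\<^esub> c a"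
  have \<xi>: "\<xi> \<in> lie_algebra \<G> G" "\<xi> c = a"
    using tangent_of_coord_in_tangent_space[OF G'(1) c] tangent_of_coord_same_chart[OF G'(2) c]
    by (auto simp: \<xi>_def c_def lie_algebra_def)
  define A where "A = frechet_derivative (snd k \<circ> \<mu> \<circ> chart_inv d) (at (snd d x))"
  have A: "((snd k \<circ> \<mu> \<circ> chart_inv d) has_derivative A) (at (snd d x))"
    unfolding A_def by (rule differentiable_map_has_derivative[OF \<mu> d k])
  \<comment> \<open>The chart \<open>k\<close> is defined on the whole dual, so by
    \<open>k_inv\<close> it cancels at every value of \<open>\<mu>\<close> on
    \<open>points X\<close>; the chain rule thus transfers on the full range of
    \<open>d\<close>.\<close>
  have "(((h \<circ> chart_inv k) \<circ> (snd k \<circ> \<mu> \<circ> chart_inv d)) has_derivative (L \<circ> A)) (at (snd d x))"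
    using L by (intro diff_chain_at[OF A]) (simp add: chart_inv_chart[OF X d'])
  then have "((h \<circ> \<mu> \<circ> chart_inv d) has_derivative (L \<circ> A)) (at (snd d x))"
    by (rule has_derivative_transform_within_open[OF _ open_chart_range[OF X d'(1)]])
      (use d' chart_subset_points[OF X d'(1)] in
        \<open>auto simp: chart_inv_chart[OF X d'(1)] k_inv \<mu>_dual\<close>)
  from frechet_derivative_at[OF this, symmetric]
  have "ext_deriv X (h \<circ> \<mu>) x v = L (A (v d))" for v
    by (simp add: ext_deriv_def differential_def charts_at_real_line d_def)
  moreover have "differential X (lie_dual_manifold \<G> G) \<mu> x v k = A (v d)" for v
    using k by (simp add: differential_def A_def d_def)
  ultimately show ?thesis
    using \<xi> a by (intro bexI[of _ \<xi>]) (auto simp: dual_pairing_def Let_def k_def c_def)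
qed

section \<open>The rigidity theorem\<close>

theorem lemma15:
  fixes M :: "('m, 'e::real_normed_vector) manifold" and \<omega> :: "('m, 'e) form2"
    and X\<^sub>0 :: "'m set" and f :: "'m \<Rightarrow> real"
    and Mt :: "('mt, 'et::real_normed_vector) manifold" and \<omega>t :: "('mt, 'et) form2"
    and M' :: "('n, 'f::real_normed_vector) manifold" and \<omega>' :: "('n, 'f) form2"
    and \<G> :: "'g monoid" and G :: "('g, 'h::real_normed_vector) manifold"
    and \<rho> :: "'g \<Rightarrow> 'mt \<Rightarrow> 'mt" and \<mu> :: "'mt \<Rightarrow> ('g, 'h) tangent \<Rightarrow> real"
    and \<psi> :: "'mt \<Rightarrow> 'm \<times> 'n"
  assumes "symplectic_manifold M \<omega>"
    and "X\<^sub>0 \<subseteq> points M"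
    and "smooth_map M real_line f"
    and "symplectic_manifold Mt \<omega>t"
    and "symplectic_manifold M' \<omega>'"
    and "lie_group \<G> G"
    and "connected_space (mtop G)"
    and "hamiltonian_action \<G> G Mt \<omega>t \<rho>"
    and "moment_map \<G> G Mt \<omega>t \<rho> \<mu>"
    and "symplectomorphism Mt \<omega>t (prod_manifold M M') (prod_form2 M M' \<omega> \<omega>') \<psi>"
    and "factors_through Mt real_line (lie_dual_manifold \<G> G) (f \<circ> fst \<circ> \<psi>) \<mu>"
    and "X\<^sub>0 = (fst \<circ> \<psi>) ` {x \<in> points Mt. \<mu> x = (\<lambda>_. 0)}"
  shows "rigidifying M \<omega> X\<^sub>0 (ext_deriv M f)"
proof -
  note X0 = assms(12)
  have sM: "smooth_manifold M" "smooth_manifold Mt" "smooth_manifold M'" "smooth_manifold G"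
    using assms(1,4,5,6) by (auto simp: symplectic_manifold_def lie_group_def)
  note cs = sM[THEN smooth_manifold_imp_chart_space]
  let ?N = "prod_manifold M M'"
  have csN: "chart_space ?N" and csA: "chart_space (prod_manifold G Mt)"
    using chart_space_prod cs by auto
  have f: "differentiable_map M real_line f"
    using smooth_map_imp_differentiable_map[OF assms(3)] .
  have \<mu>: "differentiable_map Mt (lie_dual_manifold \<G> G) \<mu>"
    using assms(9) smooth_map_imp_differentiable_map by (auto simp: moment_map_def)
  have act: "group_action \<G> (points Mt) \<rho>"
    and act_diff: "differentiable_map (prod_manifold G Mt) Mt (\<lambda>(g, x). \<rho> g x)"
    using assms(8) smooth_map_imp_differentiable_map
    by (auto simp: hamiltonian_action_def symplectic_action_def)
  have \<psi>_bij: "bij_betw \<psi> (points Mt) (points ?N)" and \<psi>: "differentiable_map Mt ?N \<psi>"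
    and \<psi>_inv: "differentiable_map ?N Mt (inv_into (points Mt) \<psi>)"
    using assms(10) smooth_map_imp_differentiable_map
    by (auto simp: symplectomorphism_def diffeomorphism_def)
  have fst_diff: "differentiable_map ?N M fst" and snd_diff: "differentiable_map ?N M' snd"
    using differentiable_map_fst[OF sM(1) cs(3)] differentiable_map_snd[OF cs(1) sM(3)] by auto
  obtain h where h: "differentiable_map (lie_dual_manifold \<G> G) real_line h"
    and fh: "\<And>x. x \<in> points Mt \<Longrightarrow> (f \<circ> fst \<circ> \<psi>) x = (h \<circ> \<mu>) x"
    using assms(11) smooth_map_imp_differentiable_map by (fastforce simp: factors_through_def)
  have pr: "differentiable_map Mt M (fst \<circ> \<psi>)" and pr': "differentiable_map Mt M' (snd \<circ> \<psi>)"
    using differentiable_map_compose[OF cs(2) csN \<psi>] fst_diff snd_diff by auto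
  have one: "\<one>\<^bsub>\<G>\<^esub> \<in> points G" "carrier \<G> = points G"
    using assms(6) group.is_monoid monoid.one_closed unfolding lie_group_def by metis+

  show ?thesis
    unfolding rigidifying_def
  proof (intro allI impI ballI, elim conjE)
    fix \<phi> x v
    assume \<phi>s: "symplectomorphism M \<omega> M \<omega> \<phi>" and fixed: "\<forall>x\<in>X\<^sub>0. \<phi> x = x"
      and x: "x \<in> X\<^sub>0" and v: "v \<in> tangent_space M x"
    have \<phi>: "differentiable_map M M \<phi>"
      using \<phi>s smooth_map_imp_differentiable_map by (auto simp: symplectomorphism_def diffeomorphism_def)
    have xM: "x \<in> points M" using x assms(2) by blast
    obtain y where y: "y \<in> points Mt" "\<mu> y = (\<lambda>_. 0)" "x = fst (\<psi> y)"
      using x X0 by auto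
    define orb where "orb = (\<lambda>g. \<rho> g y)"
    \<comment> \<open>The orbit map is the action composed with the slice sending \<open>g\<close>
      to \<open>(g, y)\<close>.\<close>
    have orb: "differentiable_map G Mt orb"
      using differentiable_map_compose[OF cs(4) csA differentiable_map_slice[OF sM(4) y(1)] act_diff]
      by (simp add: orb_def comp_def)
    have orb1: "orb \<one>\<^bsub>\<G>\<^esub> = y"
      using fun_cong[OF group_action.id_eq_one[OF act], of y] y(1) by (simp add: orb_def)
    have orb0: "(fst \<circ> \<psi> \<circ> orb) g \<in> X\<^sub>0" if g: "g \<in> points G" for g
    proof -
      have gy: "orb g \<in> points Mt"
        using differentiable_map_in_points[OF orb g] .
      have "\<mu> (orb g) \<xi> = 0" for \<xi>
      proof (cases "\<xi> \<in> lie_algebra \<G> G")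
        case True
        then show ?thesis
          using assms(9) g one(2) y(1,2) by (simp add: moment_map_def orb_def)
      next
        \<comment> \<open>Off the Lie algebra the value is 0 by the convention in
          \<open>lie_dual\<close>, which completes equality with the zero function.\<close>
        case False
        then show ?thesis
          using differentiable_map_in_points[OF \<mu> gy] by (simp add: lie_dual_manifold_def lie_dual_def)
      qed
      then show ?thesis
        unfolding X0 using gy by auto
    qed
    have F: "differentiable_map G M (fst \<circ> \<psi> \<circ> orb)"
      using differentiable_map_compose[OF cs(4) cs(2) orb pr] .
    obtain \<xi> where \<xi>: "\<xi> \<in> lie_algebra \<G> G"
      and d\<mu>: "\<And>u. ext_deriv Mt (h \<circ> \<mu>) y u
         = dual_pairing \<G> G (differential Mt (lie_dual_manifold \<G> G) \<mu> y u) \<xi>"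
      using differential_through_moment_map[OF assms(6) cs(2) y(1) \<mu> h] by blast
    define Z where "Z = generated_vector_field \<G> G Mt \<rho> \<xi> y"
    have Z_eq: "Z = differential G Mt orb \<one>\<^bsub>\<G>\<^esub> \<xi>"
      by (simp add: Z_def generated_vector_field_def orb_def)
    have Z: "Z \<in> tangent_space Mt y"
      unfolding Z_eq using differential_in_tangent_space[OF cs(4) sM(2) orb one(1)] orb1 by simp
    define Y where "Y = differential Mt M (fst \<circ> \<psi>) y Z"
    have Y: "Y \<in> tangent_space M x"
      unfolding Y_def using differential_in_tangent_space[OF cs(2) sM(1) pr y(1)] y(3) by simp
    have Y_eq: "Y = differential G M (fst \<circ> \<psi> \<circ> orb) \<one>\<^bsub>\<G>\<^esub> \<xi>"
      unfolding Y_def Z_eq using differential_compose[OF cs(4) cs(2) orb pr one(1)] orb1 by simp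
    have \<phi>Y: "differential M M \<phi> x Y = Y"
    proof -
      have "differential M M \<phi> x Y = differential G M (\<phi> \<circ> (fst \<circ> \<psi> \<circ> orb)) \<one>\<^bsub>\<G>\<^esub> \<xi>"
        unfolding Y_eq using differential_compose[OF cs(4) cs(1) F \<phi> one(1)] orb1 y(3) by simp
      \<comment> \<open>Both maps agree on all of \<open>G\<close>, because the inner one takes
        values in \<open>X\<^sub>0\<close>; hence their differentials at the neutral element
        agree.\<close>
      also have "\<dots> = Y"
        unfolding Y_eq using fixed orb0
        by (intro differential_cong[OF cs(4) one(1)] differentiable_map_compose[OF cs(4) cs(1) F \<phi>]) auto
      finally show ?thesis .
    qed
    \<comment> \<open>A tangent vector \<open>w\<close> of \<open>M\<close> is lifted to \<open>Mt\<close> along the slice \<open>M \<times> {snd (\<psi> y)}\<close>.\<close>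
    have df: "ext_deriv M f x w = \<omega> x Y w" if w: "w \<in> tangent_space M x" for w
    proof -
      define s where "s = inv_into (points Mt) \<psi> \<circ> (\<lambda>m. (m, snd (\<psi> y)))"
      have y': "snd (\<psi> y) \<in> points M'"
        using differentiable_map_in_points[OF pr' y(1)] by simp
      have s: "differentiable_map M Mt s"
        unfolding s_def
        using differentiable_map_compose[OF cs(1) csN differentiable_map_slice[OF sM(1) y'] \<psi>_inv] .
      have \<psi>s: "\<psi> (s m) = (m, snd (\<psi> y))" if "m \<in> points M" for m
        using bij_betw_inv_into_right[OF \<psi>_bij] that y' by (simp add: s_def prod_manifold_def)
      have sx: "s x = y"
        using bij_betw_inv_into_left[OF \<psi>_bij y(1)] y(3) by (simp add: s_def)
      define u where "u = differential M Mt s x w"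
      have u: "u \<in> tangent_space Mt y"
        unfolding u_def using differential_in_tangent_space[OF cs(1) sM(2) s xM] sx by simp
      have comp_fst: "differential ?N M fst (\<psi> y) (differential Mt ?N \<psi> y t) = differential Mt M (fst \<circ> \<psi>) y t" for t
        using differential_compose[OF cs(2) csN \<psi> fst_diff y(1)] by simp
      have comp_snd: "differential ?N M' snd (\<psi> y) (differential Mt ?N \<psi> y t) = differential Mt M' (snd \<circ> \<psi>) y t" for t
        using differential_compose[OF cs(2) csN \<psi> snd_diff y(1)] by simp
      \<comment> \<open>The first component of \<open>\<psi> \<circ> s\<close> is the identity of
        \<open>M\<close>, so the lift \<open>u\<close> projects back to \<open>w\<close>.\<close>
      have "differential Mt M (fst \<circ> \<psi>) y u = differential M M (fst \<circ> \<psi> \<circ> s) x w"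
        unfolding u_def using differential_compose[OF cs(1,2) s pr xM] sx by simp
      also have "\<dots> = differential M M id x w"
        by (rule differential_cong[OF cs(1) xM differentiable_map_compose[OF cs(1,2) s pr]])
          (simp add: \<psi>s)
      also have "\<dots> = w"
        by (rule differential_id[OF cs(1) xM w])
      finally have fst_u: "differential Mt M (fst \<circ> \<psi>) y u = w" .
      \<comment> \<open>The second component is constant along the slice. Its vanishing differential
        is what removes the contribution of \<open>\<omega>'\<close> below.\<close>
      have "differential Mt M' (snd \<circ> \<psi>) y u = differential M M' (snd \<circ> \<psi> \<circ> s) x w"
        unfolding u_def using differential_compose[OF cs(1,2) s pr' xM] sx by simp
      also have "\<dots> = differential M M' (\<lambda>_. snd (\<psi> y)) x w"
        by (rule differential_cong[OF cs(1) xM differentiable_map_compose[OF cs(1,2) s pr']])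
          (simp add: \<psi>s)
      finally have snd_u: "differential Mt M' (snd \<circ> \<psi>) y u = (\<lambda>_. 0)"
        by (simp add: differential_const)
      have fpr: "differentiable_map Mt real_line (f \<circ> fst \<circ> \<psi>)"
        using differentiable_map_compose[OF cs(2,1) pr f] by (simp add: o_assoc)
      have "ext_deriv M f x w = ext_deriv Mt (f \<circ> fst \<circ> \<psi>) y u"
        using differential_compose[OF cs(2,1) pr f y(1), of u] fst_u y(3)
        by (simp add: ext_deriv_def o_assoc)
      also have "\<dots> = ext_deriv Mt (h \<circ> \<mu>) y u"
        unfolding ext_deriv_def
        by (rule fun_cong[OF differential_cong[OF cs(2) y(1) fpr]]) (rule fh)
      also have "\<dots> = \<omega>t y Z u"
        unfolding d\<mu> Z_def using assms(9) \<xi> y(1) u by (simp add: moment_map_def)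
      also have "\<dots> = pullback_form2 Mt ?N \<psi> (prod_form2 M M' \<omega> \<omega>') y Z u"
        using assms(10) y(1) Z u by (simp add: symplectomorphism_def)
      also have "\<dots> = \<omega> x Y w
          + \<omega>' (snd (\<psi> y)) (differential Mt M' (snd \<circ> \<psi>) y Z) (\<lambda>_. 0)"
        unfolding pullback_form2_def prod_form2_def comp_fst comp_snd fst_u snd_u
        by (simp add: Y_def y(3))
      also have "\<omega>' (snd (\<psi> y)) (differential Mt M' (snd \<circ> \<psi>) y Z) (\<lambda>_. 0) = 0"
      proof -
        let ?t = "differential Mt M' (snd \<circ> \<psi>) y Z"
        have t: "?t \<in> tangent_space M' (snd (\<psi> y))"
          using differential_in_tangent_space[OF cs(2) sM(3) pr' y(1)] by simp
        then have "linear_on_tangent M' (snd (\<psi> y)) (\<omega>' (snd (\<psi> y)) ?t)"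
          using assms(5) y' by (simp add: symplectic_manifold_def two_form_def)
        \<comment> \<open>The zero vector is written as a combination of \<open>?t\<close> with
          coefficients 0, so that linearity in the second argument yields the value 0.\<close>
        then have "\<omega>' (snd (\<psi> y)) ?t (\<lambda>c. 0 *\<^sub>R ?t c + 0 *\<^sub>R ?t c)
            = 0 * \<omega>' (snd (\<psi> y)) ?t ?t + 0 * \<omega>' (snd (\<psi> y)) ?t ?t"
          using t unfolding linear_on_tangent_def by blast
        then show ?thesis by simp
      qed
      finally show ?thesis by simp
    qed
    have \<phi>x: "\<phi> x = x" using fixed x by blast
    have \<phi>v: "differential M M \<phi> x v \<in> tangent_space M x"
      using differential_in_tangent_space[OF cs(1) sM(1) \<phi> xM, of v] \<phi>x by simp
    \<comment> \<open>Since \<open>\<phi>\<close> fixes \<open>x\<close>, the image of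
      \<open>v\<close> is again tangent at \<open>x\<close>, and the formula \<open>df\<close> with
      the same \<open>Y\<close> applies to it.\<close>
    have "ext_deriv M f (\<phi> x) (differential M M \<phi> x v)
        = \<omega> x (differential M M \<phi> x Y) (differential M M \<phi> x v)"
      by (simp add: \<phi>x df[OF \<phi>v] \<phi>Y)
    also have "\<dots> = \<omega> x Y v"
    proof -
      have "pullback_form2 M M \<phi> \<omega> x Y v = \<omega> x Y v"
        using \<phi>s xM Y v unfolding symplectomorphism_def by blast
      then show ?thesis by (simp add: pullback_form2_def \<phi>x)
    qed
    also have "\<dots> = ext_deriv M f x v"
      using df[OF v] by simp
    finally show "ext_deriv M f (\<phi> x) (differential M M \<phi> x v) = ext_deriv M f x v" .
  qed
qed

end
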